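(* If $D\in\mathcal{F}$, then $D$ is Class-1, i.e. $\pi(D)=|V(D)|+1$.
   Context: An oriented graph is a loopless directed graph with no pair of opposite arcs. Strong diameter $2$: for every ordered pair of distinct vertices $(i,j)$ there is a directed path from $i$ to $j$ of length at most $2$. 2-connected: strong connectivity at least $2$. Paths are simple directed paths. $\mathcal{F}$ is the set of 2-connected oriented graphs $D$ with strong diameter $2$ having six distinct vertices $p,q,a,b,c,r$ such that: the arcs $p\to c$, $q\to c$, $q\to b$, $b\to r$, $a\to r$, $p\to a$ are present; every directed path from $p$ to $r$ contains $a$ or contains both $c$ and $b$; every directed path from $q$ to $r$ contains $b$ or contains both $c$ and $a$; and every directed path from $c$ to $r$ contains $a$ or $b$. Pebbling: a configuration is $C:V(D)\to\mathbb{N}$; a pebbling move along $i\to j$ removes two pebbles from $i$ and adds one to $j$; $C$ is $r$-solvable if some sequence of moves puts a pebble on root $r$; $\pi(D)$ is the minimum $t$ such that every configuration with $t$ pebbles is $r$-solvable for every root $r$. Class-1 means $\pi(D)=|V(D)|+1$. *)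

theory Defs
  imports "Graph_Theory.Graph_Theory"
begin

text \<open>The locale \<^locale>\<open>digraph\<close> already demands finiteness and excludes loops and parallel arcs.\<close>

locale oriented_graph = digraph +
  assumes no_opposite_arcs: "u \<rightarrow>\<^bsub>G\<^esub> v \<Longrightarrow> \<not> v \<rightarrow>\<^bsub>G\<^esub> u"

definition dipath :: "('a, 'b) pre_digraph \<Rightarrow> 'a \<Rightarrow> 'a list \<Rightarrow> 'a \<Rightarrow> bool" where
  "dipath D u P v \<longleftrightarrow> vpath P D \<and> hd P = u \<and> last P = v"

definition strong_diameter_2 :: "('a, 'b) pre_digraph \<Rightarrow> bool" where
  "strong_diameter_2 D \<longleftrightarrow>
     (\<forall>i\<in>verts D. \<forall>j\<in>verts D. i \<noteq> j \<longrightarrow> (\<exists>P. dipath D i P j \<and> vwalk_length P \<le> 2))"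

text \<open>Strong connectivity at least \<open>k\<close>.\<close>

definition k_strong :: "nat \<Rightarrow> ('a, 'b) pre_digraph \<Rightarrow> bool" where
  "k_strong k D \<longleftrightarrow> k < card (verts D) \<and>
     (\<forall>S. S \<subseteq> verts D \<and> card S < k \<longrightarrow> strongly_connected (induce_subgraph D (verts D - S)))"

definition family_F :: "('a, 'b) pre_digraph set" where
  "family_F = {D. oriented_graph D \<and> k_strong 2 D \<and> strong_diameter_2 D \<and>
     (\<exists>p q a b c r. {p, q, a, b, c, r} \<subseteq> verts D \<and> distinct [p, q, a, b, c, r] \<and>
        p \<rightarrow>\<^bsub>D\<^esub> c \<and> q \<rightarrow>\<^bsub>D\<^esub> c \<and> q \<rightarrow>\<^bsub>D\<^esub> b \<and> b \<rightarrow>\<^bsub>D\<^esub> r \<and> a \<rightarrow>\<^bsub>D\<^esub> r \<and> p \<rightarrow>\<^bsub>D\<^esub> a \<and>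
        (\<forall>P. dipath D p P r \<longrightarrow> a \<in> set P \<or> (c \<in> set P \<and> b \<in> set P)) \<and>
        (\<forall>P. dipath D q P r \<longrightarrow> b \<in> set P \<or> (c \<in> set P \<and> a \<in> set P)) \<and>
        (\<forall>P. dipath D c P r \<longrightarrow> a \<in> set P \<or> b \<in> set P))}"

text \<open>
  A configuration is a function \<open>C :: 'a \<Rightarrow> nat\<close> on the whole vertex type.  Values outside
  \<open>verts D\<close> are never counted and never take part in a move.
\<close>

definition config_size :: "('a, 'b) pre_digraph \<Rightarrow> ('a \<Rightarrow> nat) \<Rightarrow> nat" where
  "config_size D C = (\<Sum>v\<in>verts D. C v)"

definition pebbling_move :: "('a, 'b) pre_digraph \<Rightarrow> ('a \<Rightarrow> nat) \<Rightarrow> ('a \<Rightarrow> nat) \<Rightarrow> bool" where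
  "pebbling_move D C C' \<longleftrightarrow>
     (\<exists>i j. i \<rightarrow>\<^bsub>D\<^esub> j \<and> 2 \<le> C i \<and>
        C' = (\<lambda>v. C v - (if v = i then 2 else 0) + (if v = j then 1 else 0)))"

text \<open>The empty sequence of moves counts: a pebble already lying on \<open>r\<close> solves \<open>r\<close>.\<close>

definition solvable :: "('a, 'b) pre_digraph \<Rightarrow> 'a \<Rightarrow> ('a \<Rightarrow> nat) \<Rightarrow> bool" where
  "solvable D r C \<longleftrightarrow> (\<exists>C'. (pebbling_move D)\<^sup>*\<^sup>* C C' \<and> 1 \<le> C' r)"

text \<open>
  On a strongly connected finite digraph some \<open>t\<close> has the required property, so that
  \<open>LEAST\<close> denotes a genuine minimum.
\<close>

definition pebbling_number :: "('a, 'b) pre_digraph \<Rightarrow> nat" where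
  "pebbling_number D = (LEAST t. \<forall>C. config_size D C = t \<longrightarrow> (\<forall>r\<in>verts D. solvable D r C))"

definition class_1 :: "('a, 'b) pre_digraph \<Rightarrow> bool" where
  "class_1 D \<longleftrightarrow> pebbling_number D = card (verts D) + 1"

end

theory Submission
  imports Defs
begin

text \<open>
  Upper bound: let \<open>C\<close> be unsolvable for the root \<open>r\<close>.  Every vertex carries at most three pebbles,
  and each vertex \<open>v\<close> with at least two of them has an empty out-neighbour \<open>u v\<close> that dominates \<open>r\<close>;
  these are distinct.  If \<open>v\<close> and \<open>w\<close> carry three pebbles, a path \<open>v \<rightarrow> y \<rightarrow> u w\<close> has an empty middle
  vertex, and, since \<open>u v\<close> and \<open>u w\<close> are not joined by opposite arcs, for one of the two orders of the
  pair \<open>y\<close> can be chosen different from \<open>u v\<close>.  Letting all but one of these \<open>v\<close> choose such a \<open>w\<close>, no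
  two choosing each other, yields distinct further empty vertices \<open>y\<close>: a vertex shared by \<open>v\<close> and
  \<open>v'\<close> would solve \<open>r\<close> with the help of a chosen third one.  So the empty vertices outweigh the surplus.

  Lower bound: put three pebbles on \<open>p\<close> and \<open>q\<close>, none on \<open>a, b, c, r\<close>, and one on every other
  vertex.  A move shifts a surplus pair of pebbles along an arc, which ends as soon as it enters an
  empty vertex.  There are two pairs, so one of them has to reach \<open>r\<close> after the other has filled at
  most one of \<open>a, b, c\<close>, and the separation properties exclude this.
\<close>

section \<open>Solvability\<close>

lemma strong_diameter_2D:
  assumes "strong_diameter_2 D" "i \<in> verts D" "j \<in> verts D" "i \<noteq> j"
  shows "i \<rightarrow>\<^bsub>D\<^esub> j \<or> (\<exists>x. i \<rightarrow>\<^bsub>D\<^esub> x \<and> x \<rightarrow>\<^bsub>D\<^esub> j)"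
proof -
  obtain P where "dipath D i P j" and len: "vwalk_length P \<le> 2"
    using assms unfolding strong_diameter_2_def by blast
  then have vw: "vwalk P D" and ends: "hd P = i" "last P = j"
    by (auto simp: dipath_def vpath_def)
  then have "P \<noteq> []" by (auto simp: vwalk_def)
  then obtain P' where P: "P = i # P'" using ends by (cases P) auto
  then obtain x P'' where P': "P' = x # P''" using ends assms(4) by (cases P') auto
  show ?thesis
  proof (cases P'')
    case Nil
    then show ?thesis using vw ends P P' by (auto simp: vwalk_def)
  next
    case (Cons y Q)
    then have "Q = []" using len P P' by (simp add: vwalk_length_def)
    then show ?thesis using Cons vw ends P P' by (auto simp: vwalk_def)
  qed
qed

section \<open>Short move sequences that solve the root\<close>

lemma solvable_move:
  assumes "i \<rightarrow>\<^bsub>D\<^esub> j" "i \<noteq> j" "2 \<le> C i" "solvable D r (C(i := C i - 2, j := C j + 1))"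
  shows "solvable D r C"
proof -
  have "pebbling_move D C (C(i := C i - 2, j := C j + 1))"
    unfolding pebbling_move_def using assms(1-3)
    by (intro exI[of _ i] exI[of _ j]) auto
  with assms(4) show ?thesis
    unfolding solvable_def by (meson converse_rtranclp_into_rtranclp)
qed

lemma solvable_root: "1 \<le> C r \<Longrightarrow> solvable D r C"
  unfolding solvable_def by blast

context loopfree_digraph
begin

lemma dominates_neq: "x \<rightarrow>\<^bsub>G\<^esub> y \<Longrightarrow> x \<noteq> y"
  using adj_not_same by blast

lemma solvable_adj:
  assumes "x \<rightarrow>\<^bsub>G\<^esub> r" "2 \<le> C x" shows "solvable G r C"
  by (rule solvable_move[of x r G]; (rule solvable_root)?)
    (use assms in \<open>auto dest: dominates_neq\<close>)

lemma solvable_push: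
  assumes "x \<rightarrow>\<^bsub>G\<^esub> u" "u \<rightarrow>\<^bsub>G\<^esub> r" "2 \<le> C x" "1 \<le> C u" shows "solvable G r C"
  by (rule solvable_move[of x u G]; (rule solvable_adj[of u])?)
    (use assms in \<open>auto dest: dominates_neq\<close>)

lemma solvable_dist2:
  assumes "x \<rightarrow>\<^bsub>G\<^esub> u" "u \<rightarrow>\<^bsub>G\<^esub> r" "4 \<le> C x" shows "solvable G r C"
  by (rule solvable_move[of x u G]; (rule solvable_push[of x u])?)
    (use assms in \<open>auto dest: dominates_neq\<close>)

lemma solvable_pair:
  assumes "x \<rightarrow>\<^bsub>G\<^esub> u" "y \<rightarrow>\<^bsub>G\<^esub> u" "u \<rightarrow>\<^bsub>G\<^esub> r" "x \<noteq> y" "2 \<le> C x" "2 \<le> C y" shows "solvable G r C"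
  by (rule solvable_move[of x u G]; (rule solvable_push[of y u])?)
    (use assms in \<open>auto dest: dominates_neq\<close>)

text \<open>A move from \<open>v\<close> lifts \<open>y\<close> to two pebbles, after which
  \<open>y\<close> and \<open>w\<close> each send one to \<open>u\<close>. If \<open>y = w\<close>,
  the third pebble on \<open>w\<close> becomes a fourth, and this vertex alone feeds
  \<open>u\<close> twice.\<close>

lemma solvable_pair_via:
  assumes "v \<rightarrow>\<^bsub>G\<^esub> y" "y \<rightarrow>\<^bsub>G\<^esub> u" "w \<rightarrow>\<^bsub>G\<^esub> u" "u \<rightarrow>\<^bsub>G\<^esub> r" "v \<noteq> w"
    and "2 \<le> C v" "1 \<le> C y" "2 \<le> C w" "y = w \<Longrightarrow> 3 \<le> C w"
  shows "solvable G r C"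
proof (cases "y = w")
  case True
  show ?thesis
    by (rule solvable_move[of v y G]; (rule solvable_dist2[of y u])?)
      (use assms True in \<open>auto dest: dominates_neq\<close>)
next
  case False
  show ?thesis
    by (rule solvable_move[of v y G]; (rule solvable_pair[of y u w])?)
      (use assms False in \<open>auto dest: dominates_neq\<close>)
qed

text \<open>Here \<open>y\<close> may start empty: \<open>v\<close> and \<open>v'\<close> each send
  it one pebble, and \<open>y\<close> and \<open>w\<close> then each feed \<open>u\<close>.\<close>

lemma solvable_triple:
  assumes "v \<rightarrow>\<^bsub>G\<^esub> y" "v' \<rightarrow>\<^bsub>G\<^esub> y" "y \<rightarrow>\<^bsub>G\<^esub> u" "w \<rightarrow>\<^bsub>G\<^esub> u" "u \<rightarrow>\<^bsub>G\<^esub> r" "v \<noteq> v'" "v \<noteq> w" "v' \<noteq> w" "y \<noteq> w"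
    and "2 \<le> C v" "2 \<le> C v'" "2 \<le> C w"
  shows "solvable G r C"
  by (rule solvable_move[of v y G]; (rule solvable_pair_via[of v' y u w])?)
    (use assms in \<open>auto dest: dominates_neq\<close>)

end

section \<open>The upper bound\<close>

text \<open>The choices built by the induction form a tree directed towards
  \<open>v\<^sub>0\<close>. A new vertex \<open>x\<close> either chooses \<open>v\<^sub>0\<close>,
  or is chosen by \<open>v\<^sub>0\<close> and replaces it as the root. The value of
  \<open>f\<close> at the root is arbitrary, hence the guard.\<close>

lemma semicomplete_selection:
  assumes "finite T" "T \<noteq> {}"
    and "\<And>v w. v \<in> T \<Longrightarrow> w \<in> T \<Longrightarrow> v \<noteq> w \<Longrightarrow> Q v w \<or> Q w v"
  shows "\<exists>v\<^sub>0\<in>T. \<exists>f. \<forall>v\<in>T - {v\<^sub>0}. f v \<in> T - {v} \<and> Q v (f v) \<and> (f v \<noteq> v\<^sub>0 \<longrightarrow> f (f v) \<noteq> v)"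
  using assms
proof (induction T rule: finite_ne_induct)
  case (singleton x)
  then show ?case by auto
next
  case (insert x T)
  then obtain v\<^sub>0 f where v0: "v\<^sub>0 \<in> T"
    and f: "\<And>v. v \<in> T - {v\<^sub>0} \<Longrightarrow> f v \<in> T - {v} \<and> Q v (f v) \<and> (f v \<noteq> v\<^sub>0 \<longrightarrow> f (f v) \<noteq> v)"
    by (metis (no_types, lifting) insertCI)
  consider "Q x v\<^sub>0" | "Q v\<^sub>0 x" using insert v0 by (metis insertCI)
  then show ?case
  proof cases
    case 1
    define g where "g = f(x := v\<^sub>0)"
    have "g v \<in> insert x T - {v} \<and> Q v (g v) \<and> (g v \<noteq> v\<^sub>0 \<longrightarrow> g (g v) \<noteq> v)"
      if "v \<in> insert x T - {v\<^sub>0}" for v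
    proof (cases "v = x")
      case True
      then show ?thesis using 1 v0 insert.hyps by (auto simp: g_def)
    next
      case False
      then show ?thesis using f[of v] that insert.hyps by (auto simp: g_def)
    qed
    then show ?thesis using v0 by blast
  next
    case 2
    define g where "g = f(v\<^sub>0 := x)"
    have "g v \<in> insert x T - {v} \<and> Q v (g v) \<and> (g v \<noteq> x \<longrightarrow> g (g v) \<noteq> v)"
      if "v \<in> insert x T - {x}" for v
    proof (cases "v = v\<^sub>0")
      case True
      then show ?thesis using 2 v0 insert.hyps by (auto simp: g_def)
    next
      case False
      then show ?thesis using f[of v] that insert.hyps by (auto simp: g_def)
    qed
    then show ?thesis by blast
  qed
qed

lemma (in oriented_graph) config_size_le_if_unsolvable:
  assumes diam: "strong_diameter_2 G" and r: "r \<in> verts G" and unsolv: "\<not> solvable G r C"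
  shows "config_size G C \<le> card (verts G)"
proof -
  define Z where "Z = {v \<in> verts G. C v = 0}"
  define B where "B = {v \<in> verts G. 2 \<le> C v}"
  define T where "T = {v \<in> verts G. 3 \<le> C v}"
  have fin: "finite Z" "finite B" "finite T" by (auto simp: Z_def B_def T_def)
  have TB: "v \<in> T \<Longrightarrow> v \<in> B" for v by (simp add: T_def B_def)
  have r0: "C r = 0" using unsolv solvable_root[of C r G] by (cases "C r") auto
  have nadj: "\<not> v \<rightarrow>\<^bsub>G\<^esub> r" if "v \<in> B" for v
    using solvable_adj unsolv that by (auto simp: B_def)
  have "\<exists>u. v \<rightarrow>\<^bsub>G\<^esub> u \<and> u \<rightarrow>\<^bsub>G\<^esub> r" if "v \<in> B" for v
    using strong_diameter_2D[OF diam, of v r] nadj[OF that] that r r0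
    by (cases "v = r") (auto simp: B_def)
  then obtain u where u: "\<And>v. v \<in> B \<Longrightarrow> v \<rightarrow>\<^bsub>G\<^esub> u v" "\<And>v. v \<in> B \<Longrightarrow> u v \<rightarrow>\<^bsub>G\<^esub> r"
    by metis
  have le3: "C v \<le> 3" if "v \<in> verts G" for v
  proof (rule ccontr)
    assume "\<not> C v \<le> 3"
    then have "v \<in> B" "4 \<le> C v" using that by (auto simp: B_def)
    then show False using u solvable_dist2 unsolv by blast
  qed
  have uZ: "u v \<in> Z - {r}" if "v \<in> B" for v
  proof -
    have "C (u v) = 0"
      using solvable_push[of v "u v" r C] u[OF that] that unsolv by (force simp: B_def)
    then show ?thesis using u[OF that] nadj[OF that] by (auto simp: Z_def dest: adj_in_verts)
  qed
  have u_private: "\<not> w \<rightarrow>\<^bsub>G\<^esub> u v" if "v \<in> B" "w \<in> B" "v \<noteq> w" for v w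
    using solvable_pair[of v "u v" w r C] u[OF that(1)] that unsolv by (auto simp: B_def)
  have u_inj: "inj_on u B" using u u_private by (metis inj_onI)
  \<comment> \<open>The unit lost to the vertex that makes no choice is repaid by \<open>r\<close>,
    which is empty but lies outside \<open>S\<close> and outside the image of
    \<open>u\<close>.\<close>
  have extra: "\<exists>S \<subseteq> Z - {r} - u ` B. card T \<le> card S + 1"
  proof (cases "T = {}")
    case True
    then show ?thesis by (intro exI[of _ "{}"]) auto
  next
    case False
    define Q where "Q v w \<longleftrightarrow> (\<exists>y. y \<noteq> u v \<and> v \<rightarrow>\<^bsub>G\<^esub> y \<and> y \<rightarrow>\<^bsub>G\<^esub> u w)" for v w
    have via: "\<exists>y. v \<rightarrow>\<^bsub>G\<^esub> y \<and> y \<rightarrow>\<^bsub>G\<^esub> u w" if "v \<in> T" "w \<in> T" "v \<noteq> w" for v w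
      using strong_diameter_2D[OF diam, of v "u w"] u_private[of w v] uZ[of w] that TB
      by (cases "v = u w") (auto simp: Z_def T_def)
    \<comment> \<open>If both fail, \<open>u v\<close> is the only middle vertex from
      \<open>v\<close> to \<open>u w\<close>, and \<open>u w\<close> the only one from
      \<open>w\<close> to \<open>u v\<close>, so \<open>u v\<close> and \<open>u w\<close> dominate
      each other.\<close>
    have "Q v w \<or> Q w v" if "v \<in> T" "w \<in> T" "v \<noteq> w" for v w
      using via[of v w] via[of w v] that no_opposite_arcs[of "u v" "u w"] unfolding Q_def by metis
    from semicomplete_selection[where Q = Q, OF fin(3) False this]
    obtain v\<^sub>0 f where v0: "v\<^sub>0 \<in> T"
      and f: "\<And>v. v \<in> T - {v\<^sub>0} \<Longrightarrow> f v \<in> T - {v} \<and> Q v (f v) \<and> (f v \<noteq> v\<^sub>0 \<longrightarrow> f (f v) \<noteq> v)"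
      by blast
    then obtain s where s: "\<And>v. v \<in> T - {v\<^sub>0} \<Longrightarrow> s v \<noteq> u v \<and> v \<rightarrow>\<^bsub>G\<^esub> s v \<and> s v \<rightarrow>\<^bsub>G\<^esub> u (f v)"
      unfolding Q_def by metis
    have sZ: "s v \<in> Z - {r} - u ` B" if v: "v \<in> T - {v\<^sub>0}" for v
    proof -
      have "C (s v) = 0"
        using solvable_pair_via[of v "s v" "u (f v)" "f v" r C] s[OF v] f[OF v] u[OF TB, of "f v"]
          unsolv v by (force simp: T_def)
      \<comment> \<open>If \<open>s v = u w\<close> with \<open>w\<close> in \<open>B\<close>, then
        \<open>v\<close> dominates \<open>u w\<close>, which forces \<open>w = v\<close> and
        contradicts the choice of \<open>s v\<close> different from \<open>u v\<close>.\<close>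
      moreover have "s v \<notin> u ` B" using s[OF v] u_private[of _ v] TB v by (metis DiffD1 imageE)
      moreover have "s v \<noteq> r" using s[OF v] nadj TB v by auto
      ultimately show ?thesis using s[OF v] by (auto simp: Z_def dest: adj_in_verts)
    qed
    have target: "f v = v'" if v: "v \<in> T - {v\<^sub>0}" "v' \<in> T - {v\<^sub>0}" "v \<noteq> v'" "s v = s v'" for v v'
    proof (rule ccontr)
      assume "f v \<noteq> v'"
      moreover have "s v \<noteq> f v" using sZ[OF v(1)] f[OF v(1)] by (auto simp: Z_def T_def)
      ultimately show False
        using solvable_triple[of v "s v" v' "u (f v)" "f v" r C] v s[OF v(1)] s[OF v(2)] f[OF v(1)]
          u[OF TB, of "f v"] unsolv by (auto simp: T_def)
    qed
    \<comment> \<open>A collision of \<open>v\<close> and \<open>v'\<close> gives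
      \<open>f v = v'\<close> and, by symmetry, \<open>f v' = v\<close>: a mutual choice away from
      \<open>v\<^sub>0\<close>.\<close>
    have "inj_on s (T - {v\<^sub>0})"
      using target f by (intro inj_onI) (metis DiffE singletonI)
    then have "card (s ` (T - {v\<^sub>0})) + 1 = card T"
      using v0 fin(3) by (simp add: card_image card_gt_0_iff) (metis Suc_pred card_gt_0_iff empty_iff)
    then show ?thesis using sZ by (intro exI[of _ "s ` (T - {v\<^sub>0})"]) auto
  qed
  then obtain S where S: "S \<subseteq> Z - {r} - u ` B" "card T \<le> card S + 1" by blast
  have finS: "finite S" using S(1) fin finite_subset[of S Z] by blast
  have "card (u ` B) + card S = card (u ` B \<union> S)"
    using S(1) fin finS by (intro card_Un_disjoint[symmetric]) auto
  also have "\<dots> + 1 = card (insert r (u ` B \<union> S))"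
    using S(1) uZ fin finS by (subst card_insert_disjoint) auto
  also have "\<dots> \<le> card Z"
    using S(1) uZ fin r r0 by (intro card_mono) (auto simp: Z_def)
  finally have "card B + card T \<le> card Z"
    using S(2) u_inj by (simp add: card_image)
  moreover have "config_size G C + card Z = card (verts G) + card B + card T"
  proof -
    have ind: "card {v \<in> verts G. P v} = (\<Sum>v\<in>verts G. if P v then 1 else 0)" for P
      by (simp add: sum.If_cases Int_def)
    \<comment> \<open>Summed over all vertices, this identity, valid because \<open>C v\<close> is
      at most 3, measures the surplus as \<open>card B + card T\<close>.\<close>
    have "C v + (if C v = 0 then 1 else 0) =
        1 + (if 2 \<le> C v then 1 else 0) + (if 3 \<le> C v then 1 else 0)" if "v \<in> verts G" for v
      using le3[OF that] by auto
    then have "(\<Sum>v\<in>verts G. C v + (if C v = 0 then 1 else 0)) =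
        (\<Sum>v\<in>verts G. 1 + (if 2 \<le> C v then 1 else 0) + (if 3 \<le> C v then 1 else 0))"
      by (intro sum.cong) auto
    then show ?thesis
      unfolding config_size_def Z_def B_def T_def ind by (simp only: sum.distrib) simp
  qed
  ultimately show ?thesis by linarith
qed

section \<open>The lower bound\<close>

text \<open>Only the vertices entered after the start must avoid \<open>S\<close>, matching pebbles
  that come to rest upon entering an empty vertex.\<close>

definition reach_avoiding :: "('a, 'b) pre_digraph \<Rightarrow> 'a set \<Rightarrow> 'a \<Rightarrow> 'a \<Rightarrow> bool" where
  "reach_avoiding D S x y \<longleftrightarrow> (\<lambda>u v. u \<rightarrow>\<^bsub>D\<^esub> v \<and> v \<notin> S)\<^sup>*\<^sup>* x y"

lemma reach_avoiding_refl: "reach_avoiding D S x x"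
  by (simp add: reach_avoiding_def)

lemma reach_avoiding_step:
  "reach_avoiding D S x y \<Longrightarrow> y \<rightarrow>\<^bsub>D\<^esub> z \<Longrightarrow> z \<notin> S \<Longrightarrow> reach_avoiding D S x z"
  unfolding reach_avoiding_def by (simp add: rtranclp.rtrancl_into_rtrancl)

lemma reach_avoiding_mono:
  assumes "reach_avoiding D S x y" "S' \<subseteq> S" shows "reach_avoiding D S' x y"
  using assms unfolding reach_avoiding_def by (elim rtranclp_mono[THEN predicate2D, rotated]) auto

text \<open>Surplus pairs trace walks, while the separation hypotheses concern simple paths;
  shortcutting a walk to a path introduces no new vertex.\<close>

lemma (in wf_digraph) dipath_if_reach_avoiding:
  assumes "reach_avoiding G S x y" "x \<in> verts G" "x \<notin> S"
  shows "\<exists>P. dipath G x P y \<and> set P \<inter> S = {}"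
proof -
  have "\<exists>P. vwalk P G \<and> hd P = x \<and> last P = y \<and> set P \<inter> S = {}"
    using assms(1) unfolding reach_avoiding_def
  proof (induction rule: rtranclp_induct)
    case base
    then show ?case using assms by (intro exI[of _ "[x]"]) auto
  next
    case (step y z)
    then obtain P where P: "vwalk P G" "hd P = x" "last P = y" "set P \<inter> S = {}"
      by auto
    moreover from P(1) have "P \<noteq> []" by auto
    ultimately show ?case using step.hyps adj_in_verts(2)[of y z]
      by (intro exI[of _ "P @ [z]"]) (auto simp: vwalk_def vwalk_arcs_append)
  qed
  then obtain P where P: "vwalk P G" "hd P = x" "last P = y" "set P \<inter> S = {}" by blast
  have "P \<noteq> []" using P(1) by auto
  with P show ?thesis
    using vwalk_to_vpath_vpath[of P G] vwalk_to_vpath_subset[of _ P]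
    by (intro exI[of _ "vwalk_to_vpath P"])
      (auto simp: dipath_def vwalk_to_vpath_hd vwalk_to_vpath_last)
qed

text \<open>The vertices \<open>s\<close> and \<open>t\<close> are the present places of the two
  surplus pairs and may coincide. Upper bounds instead of exact values let the state absorb lost
  pebbles.\<close>

definition two_pairs_state ::
  "('a, 'b) pre_digraph \<Rightarrow> 'a set \<Rightarrow> 'a \<Rightarrow> 'a \<Rightarrow> 'a \<Rightarrow> ('a \<Rightarrow> nat) \<Rightarrow> bool" where
  "two_pairs_state D W p q r C \<longleftrightarrow> (\<exists>s t. reach_avoiding D W p s \<and> reach_avoiding D W q t \<and>
     (\<forall>v. C v \<le> 1 + (if v = s then 2 else 0) + (if v = t then 2 else 0)) \<and>
     (\<forall>v\<in>insert r W. C v = 0))"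

text \<open>The pair of pebbles from \<open>x\<close> has ended on \<open>z\<close>; the pair from \<open>y\<close> is still moving.\<close>

definition one_pair_state ::
  "('a, 'b) pre_digraph \<Rightarrow> 'a set \<Rightarrow> 'a \<Rightarrow> 'a \<Rightarrow> 'a \<Rightarrow> ('a \<Rightarrow> nat) \<Rightarrow> bool" where
  "one_pair_state D W x y r C \<longleftrightarrow> (\<exists>z\<in>W. \<exists>t. reach_avoiding D (W - {z}) x z \<and>
     reach_avoiding D (W - {z}) y t \<and>
     (\<forall>v. C v \<le> 1 + (if v = t then 2 else 0)) \<and> (\<forall>v\<in>insert r (W - {z}). C v = 0))"

definition no_pair_state :: "'a \<Rightarrow> ('a \<Rightarrow> nat) \<Rightarrow> bool" where
  "no_pair_state r C \<longleftrightarrow> (\<forall>v. C v \<le> 1) \<and> C r = 0"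

section \<open>The effect of a move on the surplus pairs\<close>

lemma two_pairs_state_commute:
  assumes "two_pairs_state D W p q r C" shows "two_pairs_state D W q p r C"
proof -
  obtain s t where st: "reach_avoiding D W p s" "reach_avoiding D W q t"
    "\<And>v. C v \<le> 1 + (if v = s then 2 else 0) + (if v = t then 2 else 0)"
    "\<forall>v\<in>insert r W. C v = 0"
    using assms unfolding two_pairs_state_def by blast
  have "C v \<le> 1 + (if v = t then 2 else 0) + (if v = s then 2 else 0)" for v
    using st(3)[of v] by simp
  then show ?thesis unfolding two_pairs_state_def using st by blast
qed

lemma two_pairs_state_move:
  assumes st: "two_pairs_state D W p q r C" and move: "pebbling_move D C C'"
    and W: "r \<notin> W" "\<not> reach_avoiding D W p r" "\<not> reach_avoiding D W q r"
  shows "two_pairs_state D W p q r C' \<or> one_pair_state D W p q r C' \<or> one_pair_state D W q p r C'"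
proof -
  obtain i j where ij: "i \<rightarrow>\<^bsub>D\<^esub> j" "2 \<le> C i"
    and C': "C' = (\<lambda>v. C v - (if v = i then 2 else 0) + (if v = j then 1 else 0))"
    using move unfolding pebbling_move_def by blast
  \<comment> \<open>The moving pair started at \<open>x\<close>, the resting one at
    \<open>y\<close>; both assignments of \<open>p\<close> and \<open>q\<close> to these roles are
    used.\<close>
  have *: "two_pairs_state D W x y r C' \<or> one_pair_state D W x y r C'"
    if x: "reach_avoiding D W x i" "\<not> reach_avoiding D W x r" and y: "reach_avoiding D W y t"
      and C: "\<And>v. C v \<le> 1 + (if v = i then 2 else 0) + (if v = t then 2 else 0)"
        "\<And>v. v \<in> insert r W \<Longrightarrow> C v = 0" for x y t
  proof -
    have "j \<noteq> r" using reach_avoiding_step[OF x(1) ij(1)] x(2) W(1) by auto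
    \<comment> \<open>The surplus survives on \<open>j\<close> only if \<open>j\<close> was
      occupied; on an empty \<open>j\<close> the arriving pebble is a single one.\<close>
    have bound: "C' v \<le> 1 + (if v = j \<and> C j > 0 then 2 else 0) + (if v = t then 2 else 0)" for v
      using C(1)[of v] by (auto simp: C')
    show ?thesis
    proof (cases "j \<in> W")
      case False
      have "C' v \<le> 1 + (if v = j then 2 else 0) + (if v = t then 2 else 0)" for v
        using bound[of v] by (auto split: if_splits)
      moreover have "C' v = 0" if "v \<in> insert r W" for v
        using C(2)[OF that] that False \<open>j \<noteq> r\<close> by (auto simp: C')
      ultimately have "two_pairs_state D W x y r C'"
        unfolding two_pairs_state_def using y reach_avoiding_step[OF x(1) ij(1) False] by blast
      then show ?thesis ..
    next
      case True
      have "reach_avoiding D (W - {j}) x j" "reach_avoiding D (W - {j}) y t"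
        using reach_avoiding_step[OF reach_avoiding_mono[OF x(1)] ij(1)] reach_avoiding_mono[OF y]
        by auto
      moreover have "C' v \<le> 1 + (if v = t then 2 else 0)" for v
        using bound[of v] C(2)[of j] True by (auto split: if_splits)
      moreover have "C' v = 0" if "v \<in> insert r (W - {j})" for v
        using C(2)[of v] that \<open>j \<noteq> r\<close> by (auto simp: C')
      ultimately have "one_pair_state D W x y r C'"
        unfolding one_pair_state_def using True by blast
      then show ?thesis ..
    qed
  qed
  obtain s t where st: "reach_avoiding D W p s" "reach_avoiding D W q t"
    "\<And>v. C v \<le> 1 + (if v = s then 2 else 0) + (if v = t then 2 else 0)"
    "\<And>v. v \<in> insert r W \<Longrightarrow> C v = 0"
    using st unfolding two_pairs_state_def by blast
  have "i = s \<or> i = t" using ij(2) st(3)[of i] by (auto split: if_splits)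
  then show ?thesis
  proof
    assume "i = s"
    then show ?thesis using *[of p q t] st W by blast
  next
    assume "i = t"
    moreover have "C v \<le> 1 + (if v = t then 2 else 0) + (if v = s then 2 else 0)" for v
      using st(3)[of v] by simp
    ultimately show ?thesis
      using *[of q p s] st W two_pairs_state_commute by metis
  qed
qed

text \<open>The occupied vertex \<open>z\<close> can now be crossed, so only \<open>W - {z}\<close>
  still blocks the second pair. Entering that set uses up the last surplus.\<close>

lemma one_pair_state_move:
  assumes st: "one_pair_state D W x y r C" and move: "pebbling_move D C C'" and "r \<notin> W"
    and sep: "\<And>z. z \<in> W \<Longrightarrow> reach_avoiding D (W - {z}) x z \<Longrightarrow> \<not> reach_avoiding D (W - {z}) y r"
  shows "one_pair_state D W x y r C' \<or> no_pair_state r C'"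
proof -
  obtain i j where ij: "i \<rightarrow>\<^bsub>D\<^esub> j" "2 \<le> C i"
    and C': "C' = (\<lambda>v. C v - (if v = i then 2 else 0) + (if v = j then 1 else 0))"
    using move unfolding pebbling_move_def by blast
  obtain z t where z: "z \<in> W" "reach_avoiding D (W - {z}) x z"
    and t: "reach_avoiding D (W - {z}) y t"
    and C: "\<And>v. C v \<le> 1 + (if v = t then 2 else 0)" "\<And>v. v \<in> insert r (W - {z}) \<Longrightarrow> C v = 0"
    using st unfolding one_pair_state_def by blast
  have [simp]: "t = i" using ij(2) C(1)[of i] by (auto split: if_splits)
  have "j \<noteq> r" using reach_avoiding_step[OF t, of j] ij(1) sep[OF z] \<open>r \<notin> W\<close> by auto
  have bound: "C' v \<le> 1 + (if v = j \<and> C j > 0 then 2 else 0)" for v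
    using C(1)[of v] by (auto simp: C')
  show ?thesis
  proof (cases "j \<in> W - {z}")
    case False
    have "C' v \<le> 1 + (if v = j then 2 else 0)" for v
      using bound[of v] by (auto split: if_splits)
    moreover have "C' v = 0" if "v \<in> insert r (W - {z})" for v
      using C(2)[OF that] that False \<open>j \<noteq> r\<close> by (auto simp: C')
    moreover have "reach_avoiding D (W - {z}) y j"
      using reach_avoiding_step[OF t, of j] ij(1) False by simp
    ultimately have "one_pair_state D W x y r C'"
      unfolding one_pair_state_def using z by blast
    then show ?thesis ..
  next
    case True
    have "C' v \<le> 1" for v using bound[of v] C(2)[of j] True by (auto split: if_splits)
    moreover have "C' r = 0" using C(2)[of r] \<open>j \<noteq> r\<close> by (auto simp: C')
    ultimately show ?thesis unfolding no_pair_state_def by blast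
  qed
qed

lemma no_pair_state_stuck: "no_pair_state r C \<Longrightarrow> \<not> pebbling_move D C C'"
  unfolding no_pair_state_def pebbling_move_def by (metis Suc_1 not_less_eq_eq)

lemma unsolvable_if_separated:
  assumes C: "\<And>v. C v \<le> 1 + (if v = p then 2 else 0) + (if v = q then 2 else 0)"
      "\<And>v. v \<in> insert r W \<Longrightarrow> C v = 0"
    and W: "r \<notin> W" "\<not> reach_avoiding D W p r" "\<not> reach_avoiding D W q r"
    and sep_q: "\<And>z. z \<in> W \<Longrightarrow> reach_avoiding D (W - {z}) p z \<Longrightarrow>
      \<not> reach_avoiding D (W - {z}) q r"
    and sep_p: "\<And>z. z \<in> W \<Longrightarrow> reach_avoiding D (W - {z}) q z \<Longrightarrow>
      \<not> reach_avoiding D (W - {z}) p r"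
  shows "\<not> solvable D r C"
proof -
  have inv: "two_pairs_state D W p q r C' \<or> one_pair_state D W p q r C' \<or>
      one_pair_state D W q p r C' \<or> no_pair_state r C'" if "(pebbling_move D)\<^sup>*\<^sup>* C C'" for C'
    using that
  proof (induction rule: rtranclp_induct)
    case base
    have "two_pairs_state D W p q r C"
      unfolding two_pairs_state_def using C reach_avoiding_refl[of D W]
      by (intro exI[of _ p] exI[of _ q]) simp
    then show ?case ..
  next
    case (step C' C'')
    from step.IH consider "two_pairs_state D W p q r C'" | "one_pair_state D W p q r C'" |
        "one_pair_state D W q p r C'" | "no_pair_state r C'" by blast
    then show ?case
    proof cases
      case 1
      from two_pairs_state_move[OF this step.hyps(2) W] show ?thesis by blast
    next
      case 2
      from one_pair_state_move[OF this step.hyps(2) W(1) sep_q] show ?thesis by blast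
    next
      case 3
      from one_pair_state_move[OF this step.hyps(2) W(1) sep_p] show ?thesis by blast
    next
      case 4
      then show ?thesis using step.hyps(2) no_pair_state_stuck by metis
    qed
  qed
  have "C' r = 0" if "(pebbling_move D)\<^sup>*\<^sup>* C C'" for C'
    using inv[OF that] unfolding two_pairs_state_def one_pair_state_def no_pair_state_def by auto
  then show ?thesis unfolding solvable_def by fastforce
qed

section \<open>Unsolvable configurations of every size up to the order of the digraph\<close>

lemma config_below_of_size:
  assumes "t \<le> config_size D C" "finite (verts D)"
  shows "\<exists>C'. (\<forall>v. C' v \<le> C v) \<and> config_size D C' = t"
  using assms(1)
proof (induction t)
  case 0
  then show ?case by (intro exI[of _ "\<lambda>_. 0"]) (simp add: config_size_def)
next
  case (Suc t)
  then obtain C' where C': "\<And>v. C' v \<le> C v" "config_size D C' = t" by auto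
  then have "config_size D C' < config_size D C" using Suc.prems by simp
  then obtain w where w: "w \<in> verts D" "C' w < C w"
    unfolding config_size_def by (metis leD linorder_not_less sum_mono)
  have "config_size D (C'(w := C' w + 1)) = t + 1"
    using C'(2) w(1) assms(2) by (simp add: config_size_def sum.remove[of _ w])
  moreover have "(C'(w := C' w + 1)) v \<le> C v" for v using C'(1)[of v] w(2) by auto
  ultimately show ?case by (metis Suc_eq_plus1)
qed

text \<open>Since \<open>pebbling_number\<close> is a least \<open>t\<close> over configurations of
  exactly \<open>t\<close> pebbles, every smaller size needs its own counterexample. Removing
  pebbles from the one of full size suffices, as \<open>unsolvable_if_separated\<close> asks only
  for upper bounds.\<close>

lemma family_F_unsolvable:
  assumes "D \<in> family_F" "t \<le> card (verts D)"
  shows "\<exists>C. config_size D C = t \<and> (\<exists>r\<in>verts D. \<not> solvable D r C)"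
proof -
  from assms(1) obtain p q a b c r where
    vs: "{p, q, a, b, c, r} \<subseteq> verts D" and dist: "distinct [p, q, a, b, c, r]"
    and arcs: "b \<rightarrow>\<^bsub>D\<^esub> r" "a \<rightarrow>\<^bsub>D\<^esub> r"
    and P: "\<forall>P. dipath D p P r \<longrightarrow> a \<in> set P \<or> (c \<in> set P \<and> b \<in> set P)"
    and Q: "\<forall>P. dipath D q P r \<longrightarrow> b \<in> set P \<or> (c \<in> set P \<and> a \<in> set P)"
    and "oriented_graph D"
    unfolding family_F_def by (elim CollectE conjE exE) (rule that; assumption)
  then interpret oriented_graph D by simp
  define C where "C v = (if v = p \<or> v = q then 3 else if v \<in> {a, b, c, r} then 0 else 1::nat)" for v
  have "config_size D C = card (verts D)"
  proof -
    let ?W = "{p, q, a, b, c, r}"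
    have C_vals: "C p = 3" "C q = 3" "C a = 0" "C b = 0" "C c = 0" "C r = 0"
      using dist by (simp_all add: C_def) metis+
    have "(\<Sum>v\<in>verts D - ?W. C v) = (\<Sum>v\<in>verts D - ?W. 1)"
      by (rule sum.cong) (auto simp: C_def)
    \<comment> \<open>The six special vertices carry 3 + 3 pebbles in total, an average of
      one.\<close>
    moreover have "(\<Sum>v\<in>?W. C v) = (\<Sum>v\<in>?W. 1)"
      using dist C_vals by simp
    ultimately have "config_size D C = (\<Sum>v\<in>verts D. 1)"
      unfolding config_size_def by (simp only: sum.subset_diff[OF vs finite_verts])
    then show ?thesis by simp
  qed
  then obtain C' where C': "\<And>v. C' v \<le> C v" "config_size D C' = t"
    using config_below_of_size[of t D C] assms(2) by auto
  have p_sep: "\<not> reach_avoiding D S p r" if "S = {a, c} \<or> S = {a, b}" for S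
  proof
    assume "reach_avoiding D S p r"
    moreover have "p \<in> verts D" "p \<notin> S" using vs dist that by auto
    ultimately obtain X where "dipath D p X r" "set X \<inter> S = {}"
      using dipath_if_reach_avoiding by blast
    then show False using P[rule_format, of X] that by auto
  qed
  have q_sep: "\<not> reach_avoiding D S q r" if "S = {b, c} \<or> S = {a, b}" for S
  proof
    assume "reach_avoiding D S q r"
    moreover have "q \<in> verts D" "q \<notin> S" using vs dist that by auto
    ultimately obtain X where "dipath D q X r" "set X \<inter> S = {}"
      using dipath_if_reach_avoiding by blast
    then show False using Q[rule_format, of X] that by auto
  qed
  have diff: "{a, b, c} - {a} = {b, c}" "{a, b, c} - {b} = {a, c}" "{a, b, c} - {c} = {a, b}"
    using dist by auto
  have "\<not> solvable D r C'"
  proof (rule unsolvable_if_separated[of _ p q _ "{a, b, c}"])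
    show "C' v \<le> 1 + (if v = p then 2 else 0) + (if v = q then 2 else 0)" for v
      using C'(1)[of v] by (auto simp: C_def split: if_splits)
    show "C' v = 0" if "v \<in> insert r {a, b, c}" for v
      using C'(1)[of v] that dist by (auto simp: C_def)
    show "r \<notin> {a, b, c}" using dist by auto
    show "\<not> reach_avoiding D {a, b, c} p r" "\<not> reach_avoiding D {a, b, c} q r"
      using reach_avoiding_mono[of D "{a, b, c}" _ r "{a, b}"] p_sep q_sep by auto
    show "\<not> reach_avoiding D ({a, b, c} - {z}) q r"
      if "z \<in> {a, b, c}" "reach_avoiding D ({a, b, c} - {z}) p z" for z
    proof
      assume "reach_avoiding D ({a, b, c} - {z}) q r"
      \<comment> \<open>Only \<open>z = b\<close> remains. Then \<open>p\<close> reaches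
        \<open>b\<close> avoiding \<open>a\<close> and \<open>c\<close>, and the arc from
        \<open>b\<close> to \<open>r\<close> completes a forbidden route.\<close>
      then have "z \<noteq> a" "z \<noteq> c" using q_sep diff by metis+
      then have "reach_avoiding D {a, c} p b" using that diff(2) by auto
      then have "reach_avoiding D {a, c} p r"
        by (rule reach_avoiding_step) (use arcs dist in auto)
      then show False using p_sep by blast
    qed
    show "\<not> reach_avoiding D ({a, b, c} - {z}) p r"
      if "z \<in> {a, b, c}" "reach_avoiding D ({a, b, c} - {z}) q z" for z
    proof
      assume "reach_avoiding D ({a, b, c} - {z}) p r"
      \<comment> \<open>Symmetrically \<open>z = a\<close>, and the arc from \<open>a\<close> to
        \<open>r\<close> completes a forbidden route from \<open>q\<close>.\<close>
      then have "z \<noteq> b" "z \<noteq> c" using p_sep diff by metis+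
      then have "reach_avoiding D {b, c} q a" using that diff(1) by auto
      then have "reach_avoiding D {b, c} q r"
        by (rule reach_avoiding_step) (use arcs dist in auto)
      then show False using q_sep by blast
    qed
  qed
  then show ?thesis using C'(2) vs by blast
qed

theorem theorem5:
  fixes D :: "('a, 'b) pre_digraph"
  assumes "D \<in> family_F"
  shows "class_1 D"
  unfolding class_1_def pebbling_number_def
proof (rule Least_equality)
  interpret oriented_graph D using assms by (simp add: family_F_def)
  show "\<forall>C. config_size D C = card (verts D) + 1 \<longrightarrow> (\<forall>r\<in>verts D. solvable D r C)"
    using config_size_le_if_unsolvable assms by (fastforce simp: family_F_def)
next
  fix t assume "\<forall>C. config_size D C = t \<longrightarrow> (\<forall>r\<in>verts D. solvable D r C)"
  then show "card (verts D) + 1 \<le> t"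
    using family_F_unsolvable[OF assms, of t] by (metis Suc_eq_plus1 not_less_eq_eq)
qed

end
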